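(* Let $S=K[x_1,\ldots,x_n]$ be a standard graded polynomial ring over a field $K$ and let $I\subset S$ be a nonzero proper square-free monomial ideal with $\mathrm v(I)=\alpha(I)-1$. Then $\mathrm v(I^{k})=\alpha(I)k-1$ for all $k\geq 1$.
   Context: $S=\bigoplus_{d\ge 0}S_d$ is graded with $\deg x_i=1$. A square-free monomial ideal is an ideal generated by square-free monomials. $\operatorname{Ass}(I)$ denotes the set of associated primes of $I$ (i.e. of $S/I$). For a nonzero graded ideal $I$, $\alpha(I):=\min\{\deg(f)\mid f\in I\setminus\{0\}\}$ (over homogeneous $f$). For a proper graded ideal $I$, $\mathrm{v}(I):=\min\{d\geq 0\mid \exists f\in S_d,\ \mathfrak{p}\in\operatorname{Ass}(I)\text{ with }(I:f)=\mathfrak{p}\}$, where $(I:f)=\{g\in S\mid gf\in I\}$. *)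

theory Defs
  imports
    "HOL-Library.Poly_Mapping"
    "HOL-Algebra.Algebraic_Closure_Type"
    "HOL-Algebra.Ideal_Product"
begin

text \<open>
  The polynomial ring \<open>K[x\<^sub>1, \<dots>, x\<^sub>n]\<close> is the convolution algebra of finitely supported maps from
  exponent vectors to \<open>K\<close>; the variables are indexed by a finite type \<open>'n\<close> with \<open>n = CARD('n)\<close>
  elements. The multiplication of \<^typ>\<open>('n \<Rightarrow>\<^sub>0 nat) \<Rightarrow>\<^sub>0 'k\<close> is the one of
  \<^theory>\<open>HOL-Library.Poly_Mapping\<close>, and \<open>mpoly_ring\<close> is that type viewed as a ring in the sense
  of HOL-Algebra.
\<close>

type_synonym ('n, 'k) mpoly = "('n \<Rightarrow>\<^sub>0 nat) \<Rightarrow>\<^sub>0 'k"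

abbreviation mpoly_ring :: "('n::finite, 'k::field) mpoly ring" where
  "mpoly_ring \<equiv> ring_of_type_algebra"

definition colon_ideal :: "('a, 'b) ring_scheme \<Rightarrow> 'a set \<Rightarrow> 'a \<Rightarrow> 'a set" where
  "colon_ideal R I f = {g \<in> carrier R. g \<otimes>\<^bsub>R\<^esub> f \<in> I}"

text \<open>The associated primes of \<open>R/I\<close>: prime ideals that are annihilators of some class \<open>f + I\<close>.\<close>

definition ass_primes :: "('a, 'b) ring_scheme \<Rightarrow> 'a set \<Rightarrow> 'a set set" where
  "ass_primes R I = {p. primeideal p R \<and> (\<exists>f\<in>carrier R. p = colon_ideal R I f)}"

abbreviation ideal_power :: "('a, 'b) ring_scheme \<Rightarrow> 'a set \<Rightarrow> nat \<Rightarrow> 'a set" where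
  "ideal_power R I k \<equiv> I [^]\<^bsub>ideals_set R\<^esub> k"

definition monom_degree :: "('n::finite \<Rightarrow>\<^sub>0 nat) \<Rightarrow> nat" where
  "monom_degree m = (\<Sum>i\<in>UNIV. Poly_Mapping.lookup m i)"

text \<open>The graded component \<open>S\<^sub>d\<close>, which contains \<open>0\<close>.\<close>

definition graded_comp :: "nat \<Rightarrow> ('n::finite, 'k::field) mpoly set" where
  "graded_comp d = {f. \<forall>m\<in>Poly_Mapping.keys f. monom_degree m = d}"

definition squarefree_monomial_ideal :: "('n::finite, 'k::field) mpoly set \<Rightarrow> bool" where
  "squarefree_monomial_ideal I \<longleftrightarrow>
     (\<exists>M. (\<forall>m\<in>M. \<forall>i. Poly_Mapping.lookup m i \<le> 1) \<and>
          I = genideal mpoly_ring ((\<lambda>m. Poly_Mapping.single m 1) ` M))"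

text \<open>
  Both invariants below are minima of sets of natural numbers, which are nonempty for a nonzero
  graded ideal (\<open>alpha_deg\<close>) and for a proper graded ideal (\<open>v_number\<close>), respectively; they are
  only meaningful in these cases.
\<close>

definition alpha_deg :: "('n::finite, 'k::field) mpoly set \<Rightarrow> nat" where
  "alpha_deg I = (LEAST d. \<exists>f \<in> graded_comp d. f \<in> I - {0})"

definition v_number :: "('n::finite, 'k::field) mpoly set \<Rightarrow> nat" where
  "v_number I =
     (LEAST d. \<exists>f \<in> graded_comp d. \<exists>p \<in> ass_primes mpoly_ring I. colon_ideal mpoly_ring I f = p)"

end

theory Submission
  imports Defs
begin

text \<open>
  Write \<open>\<alpha>\<close> for the least degree of a nonzero form in \<open>I\<close>. If \<open>(J : f)\<close> is prime for a nonzero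
  monomial ideal \<open>J\<close>, then this prime contains a monomial, hence a variable \<open>x\<^sub>i\<close>, and \<open>x\<^sub>i f\<close> is a
  nonzero element of \<open>J\<close>. As \<open>I\<^sup>k\<close> has no nonzero elements of degree below \<open>\<alpha> k\<close>, this gives
  \<open>v(I\<^sup>k) \<ge> \<alpha> k - 1\<close>
  (\<open>v_witness_lower_bound\<close>).

  For the reverse inequality let \<open>f\<close> be a form of degree \<open>\<alpha> - 1\<close> with \<open>(I : f)\<close> prime, let
  \<open>x\<^sup>m\<close> be a monomial of \<open>f\<close>, and let \<open>P\<close> be the set of the variables that lie in \<open>(I : f)\<close>. For
  \<open>i \<in> P\<close> the monomial \<open>x\<^sub>i x\<^sup>m\<close> lies in \<open>I\<close> and has the minimal degree \<open>\<alpha>\<close>, so it is one of the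
  square-free generators; therefore no variable of \<open>P\<close> divides \<open>x\<^sup>m\<close>. On the other hand every
  generator of \<open>I\<close> lies in the prime \<open>(I : f)\<close> and so is divisible by some variable of \<open>P\<close>;
  consequently every monomial of \<open>I\<^sup>k\<close> has degree at least \<open>k\<close> in the variables of \<open>P\<close>. Fix
  \<open>j \<in> P\<close> and put \<open>x\<^sup>w = (x\<^sub>j x\<^sup>m)\<^sup>k\<^sup>-\<^sup>1 x\<^sup>m\<close>, a monomial of degree \<open>\<alpha> k - 1\<close> and of degree \<open>k - 1\<close> in \<open>P\<close>.
  Each \<open>x\<^sub>i x\<^sup>w\<close> with \<open>i \<in> P\<close> is a product of \<open>k\<close> elements of \<open>I\<close>, whereas a multiple of \<open>x\<^sup>w\<close> by a
  monomial free of \<open>P\<close> has too small a degree in \<open>P\<close> to lie in \<open>I\<^sup>k\<close>. Hence \<open>(I\<^sup>k : x\<^sup>w)\<close> is the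
  ideal generated by the variables of \<open>P\<close> (\<open>colon_monomial_eq_variable_ideal\<close>), which is prime
  (\<open>primeideal_variable_ideal\<close>).

  The form \<open>f\<close> exists because \<open>v(I)\<close> is the minimum of a nonempty set of degrees; that the set
  is nonempty for square-free monomial ideals is \<open>squarefree_v_witness_exists\<close>.
\<close>

section \<open>The polynomial ring as a ring with carrier\<close>

lemma mpoly_ring_simps [simp]:
  "carrier (ring_of_type_algebra :: 'a::comm_ring_1 ring) = UNIV"
  "x \<otimes>\<^bsub>(ring_of_type_algebra :: 'a ring)\<^esub> y = x * y"
  "x \<oplus>\<^bsub>(ring_of_type_algebra :: 'a ring)\<^esub> y = x + y"
  "\<one>\<^bsub>(ring_of_type_algebra :: 'a ring)\<^esub> = 1"
  "\<zero>\<^bsub>(ring_of_type_algebra :: 'a ring)\<^esub> = 0"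
  by (simp_all add: ring_of_type_algebra_def)

lemma ideal_iff:
  fixes J :: "'a::comm_ring_1 set"
  shows "ideal J ring_of_type_algebra \<longleftrightarrow>
    0 \<in> J \<and> (\<forall>x\<in>J. \<forall>y\<in>J. x + y \<in> J) \<and> (\<forall>x\<in>J. \<forall>r. r * x \<in> J)"
    (is "_ \<longleftrightarrow> ?R")
proof
  assume "ideal J ring_of_type_algebra"
  then interpret ideal J "ring_of_type_algebra :: 'a ring" .
  show ?R
    using additive_subgroup.zero_closed[OF additive_subgroup_axioms]
      additive_subgroup.a_closed[OF additive_subgroup_axioms] I_l_closed by simp
next
  assume R: ?R
  interpret cring "ring_of_type_algebra :: 'a ring" by (rule cring_from_type_algebra)
  have "subgroup J (add_monoid (ring_of_type_algebra :: 'a ring))"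
  proof (rule add.subgroupI)
    fix a assume a: "a \<in> J"
    have "a \<oplus>\<^bsub>ring_of_type_algebra\<^esub> ((-1) * a) = \<zero>\<^bsub>ring_of_type_algebra\<^esub>" by simp
    then have "\<ominus>\<^bsub>ring_of_type_algebra\<^esub> a = (-1) * a"
      by (intro minus_equality) (simp_all add: add.commute)
    with R a show "\<ominus>\<^bsub>ring_of_type_algebra\<^esub> a \<in> J" by metis
  qed (use R in auto)
  with R show "ideal J ring_of_type_algebra"
    by (intro idealI) (auto simp: ring_axioms mult.commute)
qed

lemma
  fixes J :: "'a::comm_ring_1 set"
  assumes "ideal J ring_of_type_algebra"
  shows ideal_0: "0 \<in> J"
    and ideal_add: "x \<in> J \<Longrightarrow> y \<in> J \<Longrightarrow> x + y \<in> J"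
    and ideal_mult: "x \<in> J \<Longrightarrow> r * x \<in> J"
  using assms by (auto simp: ideal_iff)

lemma ideal_sum:
  fixes J :: "'a::comm_ring_1 set"
  assumes "ideal J ring_of_type_algebra" "\<And>x. x \<in> F \<Longrightarrow> h x \<in> J"
  shows "(\<Sum>x\<in>F. h x) \<in> J"
  using assms(2)
  by (induction F rule: infinite_finite_induct) (auto intro: ideal_0 ideal_add assms(1))

lemma ideal_colon:
  fixes J :: "'a::comm_ring_1 set"
  assumes "ideal J ring_of_type_algebra"
  shows "ideal (colon_ideal ring_of_type_algebra J f) ring_of_type_algebra"
  using assms by (auto simp: ideal_iff colon_ideal_def algebra_simps)

lemma ideal_power_Suc:
  "ideal_power R I (Suc k) = ideal_prod R (ideal_power R I k) I"
  by (simp add: nat_pow_def ideals_set_def)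

lemma ideal_power_0: "ideal_power R I 0 = carrier R"
  by (simp add: nat_pow_def ideals_set_def)

lemma ideal_ideal_power:
  assumes "ideal I (ring_of_type_algebra :: 'a::comm_ring_1 ring)"
  shows "ideal (ideal_power ring_of_type_algebra I k) ring_of_type_algebra"
proof (induction k)
  case 0
  show ?case unfolding ideal_power_0 by (simp add: ideal_iff)
next
  case (Suc k)
  interpret cring "ring_of_type_algebra :: 'a ring" by (rule cring_from_type_algebra)
  show ?case unfolding ideal_power_Suc by (rule ideal_prod_is_ideal) (fact Suc assms)+
qed

lemma power_mult_in_ideal_power:
  fixes x y :: "'a::comm_ring_1"
  assumes "x \<in> I" "y \<in> I"
  shows "x ^ k * y \<in> ideal_power ring_of_type_algebra I (Suc k)"
proof -
  have "x ^ k \<in> ideal_power ring_of_type_algebra I k"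
  proof (induction k)
    case 0
    show ?case unfolding ideal_power_0 by simp
  next
    case (Suc k)
    then show ?case
      unfolding ideal_power_Suc using ideal_prod.prod[OF Suc assms(1), of ring_of_type_algebra] by (simp add: mult.commute)
  qed
  then show ?thesis
    unfolding ideal_power_Suc using ideal_prod.prod[OF _ assms(2), of _ _ ring_of_type_algebra] by fastforce
qed

section \<open>Monomials of products\<close>

lemma keys_multE:
  assumes "m \<in> Poly_Mapping.keys (f * g)"
  obtains a b where "a \<in> Poly_Mapping.keys f" "b \<in> Poly_Mapping.keys g" "m = a + b"
  using assms keys_mult[of f g] by blast

text \<open>
  The convolution sum for the coefficient at \<open>u + v\<close> collapses if \<open>u + v\<close> arises from the two
  supports in one way only. This covers multiplication by a monomial as well as products of
  leading terms.
\<close>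

lemma lookup_mult_unique:
  fixes f g :: "'a::comm_monoid_add \<Rightarrow>\<^sub>0 'b::comm_ring_1"
  assumes uniq: "\<And>a b. a \<in> Poly_Mapping.keys f \<Longrightarrow> b \<in> Poly_Mapping.keys g \<Longrightarrow>
                   a + b = u + v \<Longrightarrow> a = u \<and> b = v"
    and u: "u \<in> Poly_Mapping.keys f" and v: "v \<in> Poly_Mapping.keys g"
  shows "Poly_Mapping.lookup (f * g) (u + v) = Poly_Mapping.lookup f u * Poly_Mapping.lookup g v"
proof -
  define f' where "f' = f - Poly_Mapping.single u (Poly_Mapping.lookup f u)"
  define g' where "g' = g - Poly_Mapping.single v (Poly_Mapping.lookup g v)"
  have keys: "Poly_Mapping.keys f' \<subseteq> Poly_Mapping.keys f - {u}"
    "Poly_Mapping.keys g' \<subseteq> Poly_Mapping.keys g - {v}"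
    by (auto simp: f'_def g'_def in_keys_iff lookup_minus lookup_single when_def split: if_splits)
  have "f * g = Poly_Mapping.single u (Poly_Mapping.lookup f u) *
                Poly_Mapping.single v (Poly_Mapping.lookup g v)
      + Poly_Mapping.single u (Poly_Mapping.lookup f u) * g' + f' * g"
    by (simp add: f'_def g'_def algebra_simps)
  moreover have "u + v \<notin> Poly_Mapping.keys (Poly_Mapping.single u (Poly_Mapping.lookup f u) * g')"
  proof
    assume "u + v \<in> Poly_Mapping.keys (Poly_Mapping.single u (Poly_Mapping.lookup f u) * g')"
    then obtain b where "b \<in> Poly_Mapping.keys g'" "u + v = u + b"
      by (rule keys_multE) (auto split: if_splits)
    with uniq[of u b] u keys show False by auto
  qed
  moreover have "u + v \<notin> Poly_Mapping.keys (f' * g)"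
  proof
    assume "u + v \<in> Poly_Mapping.keys (f' * g)"
    then obtain a b where "a \<in> Poly_Mapping.keys f'" "b \<in> Poly_Mapping.keys g" "u + v = a + b"
      by (rule keys_multE)
    with uniq[of a b] keys show False by auto
  qed
  ultimately show ?thesis
    by (simp add: lookup_add mult_single in_keys_iff)
qed

lemma add_in_keys_mult_monomial:
  fixes f :: "'a::cancel_comm_monoid_add \<Rightarrow>\<^sub>0 'b::comm_ring_1"
  assumes "u \<in> Poly_Mapping.keys f"
  shows "u + m \<in> Poly_Mapping.keys (f * Poly_Mapping.single m 1)"
proof -
  have "Poly_Mapping.lookup (f * Poly_Mapping.single m 1) (u + m)
      = Poly_Mapping.lookup f u * Poly_Mapping.lookup (Poly_Mapping.single m 1) m"
    by (rule lookup_mult_unique) (use assms in auto)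
  with assms show ?thesis by (simp add: in_keys_iff)
qed

section \<open>Ideals spanned by monomials\<close>

definition mon_span :: "'a set \<Rightarrow> ('a \<Rightarrow>\<^sub>0 'k::zero) set" where
  "mon_span A = {f. Poly_Mapping.keys f \<subseteq> A}"

definition multiples :: "'a::monoid_add set \<Rightarrow> 'a set" where
  "multiples M = {g + r | g r. g \<in> M}"

lemma ideal_mon_span:
  assumes "\<And>a r. a \<in> A \<Longrightarrow> a + r \<in> A"
  shows "ideal (mon_span A :: ('a::comm_monoid_add \<Rightarrow>\<^sub>0 'k::comm_ring_1) set) ring_of_type_algebra"
  unfolding ideal_iff mon_span_def
proof safe
  fix x y :: "'a \<Rightarrow>\<^sub>0 'k" and a
  assume "Poly_Mapping.keys x \<subseteq> A" "Poly_Mapping.keys y \<subseteq> A" "a \<in> Poly_Mapping.keys (x + y)"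
  then show "a \<in> A" using keys_add[of x y] by blast
next
  fix x r :: "'a \<Rightarrow>\<^sub>0 'k" and a
  assume x: "Poly_Mapping.keys x \<subseteq> A" and "a \<in> Poly_Mapping.keys (r * x)"
  then obtain b c where "c \<in> Poly_Mapping.keys x" "a = b + c" by (blast elim: keys_multE)
  with x assms[of c b] show "a \<in> A" by (auto simp: add.commute)
qed auto

lemma monomial_nonzero: "Poly_Mapping.single m (1::'k::zero_neq_one) \<noteq> 0"
proof
  assume "Poly_Mapping.single m (1::'k) = 0"
  from arg_cong[OF this, of "\<lambda>f. Poly_Mapping.lookup f m"] show False by simp
qed

lemma mon_spanD: "f \<in> mon_span A \<Longrightarrow> m \<in> Poly_Mapping.keys f \<Longrightarrow> m \<in> A"
  by (auto simp: mon_span_def)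

lemma self_in_multiples: "g \<in> M \<Longrightarrow> g \<in> multiples M"
  unfolding multiples_def by (rule CollectI, rule exI[of _ g], rule exI[of _ 0]) simp

lemma add_in_multiples: "a \<in> multiples M \<Longrightarrow> a + r \<in> multiples M"
  by (auto simp: multiples_def) (metis add.assoc)

lemma ideal_mon_span_multiples:
  "ideal (mon_span (multiples M) :: ('a::comm_monoid_add \<Rightarrow>\<^sub>0 'k::comm_ring_1) set)
     ring_of_type_algebra"
  by (rule ideal_mon_span) (rule add_in_multiples)

lemma poly_mapping_eq_sum_single:
  "f = (\<Sum>m\<in>Poly_Mapping.keys f. Poly_Mapping.single m (Poly_Mapping.lookup f m))"
  by (rule poly_mapping_eqI) (auto simp: lookup_sum lookup_single when_def in_keys_iff)

lemma mon_span_least: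
  fixes J :: "('a::comm_monoid_add \<Rightarrow>\<^sub>0 'k::comm_ring_1) set"
  assumes J: "ideal J ring_of_type_algebra" and A: "\<And>a. a \<in> A \<Longrightarrow> Poly_Mapping.single a 1 \<in> J"
  shows "mon_span A \<subseteq> J"
proof
  fix f :: "'a \<Rightarrow>\<^sub>0 'k" assume f: "f \<in> mon_span A"
  have terms: "Poly_Mapping.single m (Poly_Mapping.lookup f m) \<in> J" if "m \<in> Poly_Mapping.keys f" for m
  proof -
    have "Poly_Mapping.single 0 (Poly_Mapping.lookup f m) * Poly_Mapping.single m 1 \<in> J"
      using f that by (intro ideal_mult J A) (auto simp: mon_span_def)
    then show ?thesis by (simp add: mult_single)
  qed
  have "(\<Sum>m\<in>Poly_Mapping.keys f. Poly_Mapping.single m (Poly_Mapping.lookup f m)) \<in> J"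
    by (rule ideal_sum[OF J terms])
  then show "f \<in> J" by (simp only: poly_mapping_eq_sum_single[symmetric])
qed

lemma genideal_monomials:
  "genideal ring_of_type_algebra ((\<lambda>m. Poly_Mapping.single m 1) ` M)
     = (mon_span (multiples M) :: ('a::comm_monoid_add \<Rightarrow>\<^sub>0 'k::comm_ring_1) set)"
  (is "genideal ?R ?X = ?S")
proof
  interpret cring ?R by (rule cring_from_type_algebra)
  show "genideal ?R ?X \<subseteq> ?S"
    by (intro genideal_minimal ideal_mon_span_multiples)
       (auto simp: mon_span_def intro: self_in_multiples)
  have id: "ideal (genideal ?R ?X) ?R" by (rule genideal_ideal) simp
  show "?S \<subseteq> genideal ?R ?X"
  proof (rule mon_span_least[OF id])
    fix a assume "a \<in> multiples M"
    then obtain g r where gr: "g \<in> M" "a = g + r" by (auto simp: multiples_def)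
    have "Poly_Mapping.single r 1 * Poly_Mapping.single g 1 \<in> genideal ?R ?X"
      using genideal_self[of ?X] gr by (intro ideal_mult id) auto
    then show "Poly_Mapping.single a 1 \<in> genideal ?R ?X"
      by (simp add: mult_single gr add.commute)
  qed
qed

section \<open>Degrees with respect to a set of variables\<close>

definition deg_in :: "'n set \<Rightarrow> ('n::finite \<Rightarrow>\<^sub>0 nat) \<Rightarrow> nat" where
  "deg_in P m = (\<Sum>i\<in>P. Poly_Mapping.lookup m i)"

abbreviation exp_var :: "'n \<Rightarrow> 'n \<Rightarrow>\<^sub>0 nat" where
  "exp_var i \<equiv> Poly_Mapping.single i (Suc 0)"

lemma deg_in_add [simp]: "deg_in P (a + b) = deg_in P a + deg_in P b"
  by (simp add: deg_in_def lookup_add sum.distrib)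

lemma deg_in_0 [simp]: "deg_in P 0 = 0"
  by (simp add: deg_in_def)

lemma deg_in_exp_var [simp]: "deg_in P (exp_var i) = (if i \<in> P then 1 else 0)"
  by (auto simp: deg_in_def lookup_single when_def)

lemma deg_in_UNIV [simp]: "deg_in UNIV = monom_degree"
  by (simp add: fun_eq_iff deg_in_def monom_degree_def)

lemma monom_degree_add [simp]: "monom_degree (a + b) = monom_degree a + monom_degree b"
  using deg_in_add[of UNIV a b] by simp

lemma monom_degree_exp_var [simp]: "monom_degree (exp_var i) = 1"
  using deg_in_exp_var[of UNIV i] by simp

lemma monom_degree_eq_0_iff: "monom_degree m = 0 \<longleftrightarrow> m = 0"
proof
  assume "monom_degree m = 0"
  then show "m = 0" by (intro poly_mapping_eqI) (simp add: monom_degree_def)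
qed (simp add: monom_degree_def)

lemma split_off_variable:
  assumes "0 < Poly_Mapping.lookup m i"
  obtains r where "m = exp_var i + r"
proof
  show "m = exp_var i + (m - exp_var i)"
    using assms by (intro poly_mapping_eqI) (auto simp: lookup_add lookup_minus lookup_single when_def)
qed

lemma deg_in_posE:
  assumes "0 < deg_in P m"
  obtains i r where "i \<in> P" "m = exp_var i + r"
proof -
  obtain i where "i \<in> P" "0 < Poly_Mapping.lookup m i"
    using assms by (auto simp: deg_in_def sum_eq_0_iff simp flip: neq0_conv)
  from this(2) obtain r where "m = exp_var i + r" by (rule split_off_variable)
  with \<open>i \<in> P\<close> show thesis by (rule that)
qed

lemma deg_in_replicate: "deg_in P (\<Sum>_<n. a) = n * deg_in P a" for n :: nat
  by (induction n) simp_all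

lemma monom_degree_replicate: "monom_degree (\<Sum>_<n. a) = n * monom_degree a" for n :: nat
  using deg_in_replicate[of UNIV a n] by (simp del: sum_constant)

lemma single_power_replicate:
  "Poly_Mapping.single a (1::'k::comm_ring_1) ^ n = Poly_Mapping.single (\<Sum>_<n. a) 1"
proof (induction n)
  case (Suc n)
  then show ?case by (simp add: mult_single add.commute del: sum_constant)
qed simp

text \<open>
  The degree is additive on products of monomials. The bound has two uses: with all variables it
  bounds \<open>v(I\<^sup>k)\<close> from below, and with the variables of a prime over \<open>I\<close> it bounds a colon ideal
  of \<open>I\<^sup>k\<close> from above.
\<close>

lemma ideal_power_subset_mon_span:
  fixes I :: "('n::finite, 'k::field) mpoly set"
  assumes "I \<subseteq> mon_span {m. d \<le> deg_in P m}"
  shows "ideal_power mpoly_ring I k \<subseteq> mon_span {m. d * k \<le> deg_in P m}"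
proof (induction k)
  case 0
  then show ?case by (simp add: mon_span_def)
next
  case (Suc k)
  show ?case
  proof
    fix f assume "f \<in> ideal_power mpoly_ring I (Suc k)"
    then have "f \<in> ideal_prod mpoly_ring (ideal_power mpoly_ring I k) I"
      by (simp only: ideal_power_Suc)
    then show "f \<in> mon_span {m. d * Suc k \<le> deg_in P m}"
    proof induction
      case (prod i j)
      have "d * Suc k \<le> deg_in P m" if m: "m \<in> Poly_Mapping.keys (i * j)" for m
      proof -
        obtain a b where "a \<in> Poly_Mapping.keys i" "b \<in> Poly_Mapping.keys j" "m = a + b"
          using m by (rule keys_multE)
        moreover from this have "d * k \<le> deg_in P a" "d \<le> deg_in P b"
          using prod Suc assms by (auto simp: mon_span_def)
        ultimately show ?thesis by simp
      qed
      then show ?case by (auto simp: mon_span_def)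
    next
      case (sum s t)
      then show ?case using keys_add[of s t] by (auto simp: mon_span_def)
    qed
  qed
qed

section \<open>Prime ideals generated by variables\<close>

abbreviation variable_ideal :: "'n set \<Rightarrow> ('n::finite, 'k::field) mpoly set" where
  "variable_ideal P \<equiv> mon_span {m. 0 < deg_in P m}"

text \<open>
  The index type \<open>'n\<close> carries no order, so exponent vectors over it are not ordered either. An
  additive embedding into exponent vectors indexed by \<open>nat\<close>, which are linearly ordered compatibly
  with addition, provides a monomial order.
\<close>

lemma monomial_order_exists:
  obtains \<phi> :: "('n::finite \<Rightarrow>\<^sub>0 nat) \<Rightarrow> (nat \<Rightarrow>\<^sub>0 nat)"
  where "inj \<phi>" "\<And>a b. \<phi> (a + b) = \<phi> a + \<phi> b"
proof -
  obtain e :: "'n \<Rightarrow> nat" where e: "inj e"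
    using finite_imp_inj_to_nat_seg[of "UNIV :: 'n set"] by auto
  define \<phi> where "\<phi> (m :: 'n \<Rightarrow>\<^sub>0 nat) = (\<Sum>i\<in>UNIV. Poly_Mapping.single (e i) (Poly_Mapping.lookup m i))" for m
  have lookup: "Poly_Mapping.lookup (\<phi> m) (e i) = Poly_Mapping.lookup m i" for m i
    using e by (simp add: \<phi>_def lookup_sum lookup_single when_def inj_eq)
  show thesis
  proof
    show "inj \<phi>"
    proof (rule injI, rule poly_mapping_eqI)
      fix a b i assume "\<phi> a = \<phi> b"
      then show "Poly_Mapping.lookup a i = Poly_Mapping.lookup b i"
        using lookup[of a i] lookup[of b i] by simp
    qed
    show "\<phi> (a + b) = \<phi> a + \<phi> b" for a b
      by (simp add: \<phi>_def lookup_add single_add sum.distrib)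
  qed
qed

text \<open>
  Given two polynomials outside the ideal, consider in each of them the largest monomial without
  variables of \<open>P\<close>. The product of these two monomials is again free of \<open>P\<close>, and it cannot cancel:
  a pair of monomials with this product must be free of \<open>P\<close>, and then maximality forces it to be
  the chosen pair.
\<close>

lemma primeideal_variable_ideal:
  "primeideal (variable_ideal P :: ('n::finite, 'k::field) mpoly set) mpoly_ring"
proof (rule primeidealI)
  show "ideal (variable_ideal P :: ('n, 'k) mpoly set) mpoly_ring"
    by (rule ideal_mon_span) simp
  show "cring (mpoly_ring :: ('n, 'k) mpoly ring)" by (rule cring_from_type_algebra)
  have "1 \<notin> (variable_ideal P :: ('n, 'k) mpoly set)"
    by (simp add: mon_span_def)
  then show "carrier mpoly_ring \<noteq> (variable_ideal P :: ('n, 'k) mpoly set)" by auto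
next
  fix f g :: "('n, 'k) mpoly"
  assume "f \<otimes>\<^bsub>mpoly_ring\<^esub> g \<in> variable_ideal P"
  then have fg: "f * g \<in> variable_ideal P" by simp
  show "f \<in> variable_ideal P \<or> g \<in> variable_ideal P"
  proof (rule ccontr)
    assume neg: "\<not> ?thesis"
    obtain \<phi> :: "('n \<Rightarrow>\<^sub>0 nat) \<Rightarrow> (nat \<Rightarrow>\<^sub>0 nat)"
      where \<phi>: "inj \<phi>" "\<And>a b. \<phi> (a + b) = \<phi> a + \<phi> b"
      by (rule monomial_order_exists) blast
    \<comment> \<open>the monomials of \<open>h\<close> that survive modulo the variables of \<open>P\<close>\<close>
    define L where "L h = {m \<in> Poly_Mapping.keys h. deg_in P m = 0}" for h :: "('n, 'k) mpoly"
    have leading: "\<exists>u\<in>L h. \<forall>a\<in>L h. \<phi> a \<le> \<phi> u" if "h \<notin> variable_ideal P" for h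
    proof -
      have fin: "finite (\<phi> ` L h)" by (simp add: L_def)
      moreover have "\<phi> ` L h \<noteq> {}"
        using that by (auto simp: L_def mon_span_def)
      ultimately have "Max (\<phi> ` L h) \<in> \<phi> ` L h" by (rule Max_in)
      then obtain u where u: "u \<in> L h" "Max (\<phi> ` L h) = \<phi> u" by (rule imageE) simp
      have "\<phi> a \<le> \<phi> u" if "a \<in> L h" for a
        using Max_ge[OF fin imageI[OF that]] u(2) by simp
      with u(1) show ?thesis by (intro bexI ballI)
    qed
    obtain u v where u: "u \<in> L f" "\<And>a. a \<in> L f \<Longrightarrow> \<phi> a \<le> \<phi> u"
      and v: "v \<in> L g" "\<And>a. a \<in> L g \<Longrightarrow> \<phi> a \<le> \<phi> v"
      using neg leading[of f] leading[of g] by metis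
    have "Poly_Mapping.lookup (f * g) (u + v) = Poly_Mapping.lookup f u * Poly_Mapping.lookup g v"
    proof (rule lookup_mult_unique)
      fix a b assume ab: "a \<in> Poly_Mapping.keys f" "b \<in> Poly_Mapping.keys g" "a + b = u + v"
      have "deg_in P a + deg_in P b = 0"
        using u(1) v(1) arg_cong[OF ab(3), of "deg_in P"] by (simp add: L_def)
      with ab have "a \<in> L f" "b \<in> L g" by (auto simp: L_def)
      then have le: "\<phi> a \<le> \<phi> u" "\<phi> b \<le> \<phi> v" using u v by auto
      have eq: "\<phi> a + \<phi> b = \<phi> u + \<phi> v" by (simp only: ab(3) flip: \<phi>(2))
      have "\<not> \<phi> a < \<phi> u"
      proof
        assume "\<phi> a < \<phi> u"
        from add_less_le_mono[OF this le(2)] show False by (simp add: eq)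
      qed
      with le have "\<phi> a = \<phi> u" by simp
      with eq \<phi>(1) show "a = u \<and> b = v" by (simp add: inj_eq)
    qed (use u v in \<open>auto simp: L_def\<close>)
    also have "\<dots> \<noteq> 0" using u(1) v(1) by (simp add: L_def in_keys_iff)
    finally have "u + v \<in> Poly_Mapping.keys (f * g)" by (simp add: in_keys_iff)
    with fg have "0 < deg_in P (u + v)" by (auto simp: mon_span_def)
    with u(1) v(1) show False by (simp add: L_def)
  qed
qed

text \<open>Primality is applied to the factors of \<open>x\<^sup>m\<close> one variable at a time.\<close>

lemma primeideal_contains_variable:
  fixes p :: "('n::finite, 'k::field) mpoly set"
  assumes p: "primeideal p mpoly_ring"
  shows "Poly_Mapping.single m 1 \<in> p \<Longrightarrow>
    \<exists>i r. m = exp_var i + r \<and> Poly_Mapping.single (exp_var i) 1 \<in> p"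
proof (induction "monom_degree m" arbitrary: m rule: less_induct)
  case less
  interpret primeideal p "mpoly_ring :: ('n, 'k) mpoly ring" by fact
  have "m \<noteq> 0"
    using less.prems one_imp_carrier I_notcarr by auto
  then have "0 < deg_in UNIV m" by (simp add: monom_degree_eq_0_iff flip: neq0_conv)
  then obtain i r where m: "m = exp_var i + r" by (rule deg_in_posE)
  have "Poly_Mapping.single (exp_var i) 1 * Poly_Mapping.single r (1::'k) \<in> p"
    using less.prems by (simp add: m mult_single)
  then consider "Poly_Mapping.single (exp_var i) (1::'k) \<in> p" | "Poly_Mapping.single r (1::'k) \<in> p"
    using I_prime by fastforce
  then show ?case
  proof cases
    case 2
    then obtain j s where "r = exp_var j + s" "Poly_Mapping.single (exp_var j) (1::'k) \<in> p"
      using less.hyps[of r] m by auto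
    with m show ?thesis by (metis add.left_commute)
  qed (use m in blast)
qed

section \<open>Computing v-numbers\<close>

text \<open>
  As the monomials of \<open>J\<close> have larger degree in \<open>P\<close> than \<open>x\<^sup>m\<close>, each monomial of a cofactor that
  brings \<open>x\<^sup>m\<close> into \<open>J\<close> must contribute a variable of \<open>P\<close>; the last assumption says that any one
  such variable is enough.
\<close>

lemma colon_monomial_eq_variable_ideal:
  fixes J :: "('n::finite, 'k::field) mpoly set"
  assumes J: "ideal J mpoly_ring" "J \<subseteq> mon_span {a. deg_in P m < deg_in P a}"
    and mem: "\<And>i. i \<in> P \<Longrightarrow> Poly_Mapping.single (exp_var i + m) 1 \<in> J"
  shows "colon_ideal mpoly_ring J (Poly_Mapping.single m 1) = variable_ideal P"
proof
  show "colon_ideal mpoly_ring J (Poly_Mapping.single m 1) \<subseteq> variable_ideal P"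
  proof
    fix g assume "g \<in> colon_ideal mpoly_ring J (Poly_Mapping.single m 1)"
    then have "g * Poly_Mapping.single m 1 \<in> J" by (simp add: colon_ideal_def)
    with J(2) have gm: "g * Poly_Mapping.single m 1 \<in> mon_span {a. deg_in P m < deg_in P a}" by (rule subsetD)
    have "deg_in P m < deg_in P (u + m)" if "u \<in> Poly_Mapping.keys g" for u
      using mon_spanD[OF gm add_in_keys_mult_monomial[OF that]] by simp
    then show "g \<in> variable_ideal P" by (auto simp: mon_span_def)
  qed
  show "variable_ideal P \<subseteq> colon_ideal mpoly_ring J (Poly_Mapping.single m 1)"
  proof (rule mon_span_least)
    fix a assume "a \<in> {m. 0 < deg_in P m}"
    then obtain i r where a: "i \<in> P" "a = exp_var i + r" by (auto elim: deg_in_posE)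
    have "Poly_Mapping.single r 1 * Poly_Mapping.single (exp_var i + m) 1 \<in> J"
      by (intro ideal_mult J(1) mem a)
    then show "Poly_Mapping.single a 1 \<in> colon_ideal mpoly_ring J (Poly_Mapping.single m 1)"
      by (simp add: colon_ideal_def a mult_single ac_simps)
  qed (rule ideal_colon[OF J(1)])
qed

text \<open>
  The degrees whose minimum is the v-number. A prime of the form \<open>(J : f)\<close> is an associated prime
  by definition, so it suffices to ask for primality.
\<close>

definition v_witness :: "('n::finite, 'k::field) mpoly set \<Rightarrow> nat \<Rightarrow> bool" where
  "v_witness J d \<longleftrightarrow>
     (\<exists>f \<in> graded_comp d. primeideal (colon_ideal mpoly_ring J f) mpoly_ring)"

lemma v_number_eq_Least_v_witness: "v_number J = (LEAST d. v_witness J d)"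
  by (simp add: v_number_def v_witness_def ass_primes_def) metis

lemma v_witness_monomial:
  fixes J :: "('n::finite, 'k::field) mpoly set"
  assumes "ideal J mpoly_ring" "J \<subseteq> mon_span {a. deg_in P m < deg_in P a}"
    and "\<And>i. i \<in> P \<Longrightarrow> Poly_Mapping.single (exp_var i + m) 1 \<in> J"
  shows "v_witness J (monom_degree m)"
  unfolding v_witness_def
proof
  show "Poly_Mapping.single m 1 \<in> graded_comp (monom_degree m)" by (simp add: graded_comp_def)
  show "primeideal (colon_ideal mpoly_ring J (Poly_Mapping.single m 1)) mpoly_ring"
    using assms by (simp only: colon_monomial_eq_variable_ideal primeideal_variable_ideal)
qed

text \<open>
  The prime \<open>(J : f)\<close> contains \<open>x\<^sup>u \<in> J\<close>, hence a variable \<open>x\<^sub>i\<close>; then \<open>x\<^sub>i f\<close> is a nonzero element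
  of \<open>J\<close> of degree \<open>d + 1\<close>.
\<close>

lemma v_witness_lower_bound:
  fixes J :: "('n::finite, 'k::field) mpoly set"
  assumes J: "ideal J mpoly_ring" "J \<subseteq> mon_span {m. D \<le> monom_degree m}"
    and mem: "Poly_Mapping.single u 1 \<in> J" and wit: "v_witness J d"
  shows "D \<le> Suc d"
proof -
  obtain f where f: "f \<in> graded_comp d" and p: "primeideal (colon_ideal mpoly_ring J f) mpoly_ring"
    using wit by (auto simp: v_witness_def)
  interpret primeideal "colon_ideal mpoly_ring J f" "mpoly_ring :: ('n, 'k) mpoly ring" by fact
  have "f * Poly_Mapping.single u 1 \<in> J" by (intro ideal_mult J(1) mem)
  then have "Poly_Mapping.single u 1 \<in> colon_ideal mpoly_ring J f"
    by (simp add: colon_ideal_def mult.commute)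
  then obtain i where "Poly_Mapping.single (exp_var i) 1 \<in> colon_ideal mpoly_ring J f"
    using primeideal_contains_variable[OF p] by blast
  then have i: "f * Poly_Mapping.single (exp_var i) 1 \<in> J"
    by (simp add: colon_ideal_def mult.commute)
  have "f \<noteq> 0"
    using I_notcarr ideal_0[OF J(1)] by (auto simp: colon_ideal_def)
  then obtain m where m: "m \<in> Poly_Mapping.keys f" by fastforce
  from J(2) i have "f * Poly_Mapping.single (exp_var i) 1 \<in> mon_span {m. D \<le> monom_degree m}" by (rule subsetD)
  then have "D \<le> monom_degree (m + exp_var i)"
    using mon_spanD[OF _ add_in_keys_mult_monomial[OF m]] by blast
  with f m show ?thesis by (simp add: graded_comp_def)
qed

section \<open>Square-free monomial ideals\<close>

definition exp_set :: "'n::finite set \<Rightarrow> 'n \<Rightarrow>\<^sub>0 nat" where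
  "exp_set A = (\<Sum>i\<in>A. exp_var i)"

lemma lookup_exp_set: "Poly_Mapping.lookup (exp_set A) i = (if i \<in> A then 1 else 0)"
  by (simp add: exp_set_def lookup_sum lookup_single when_def)

text \<open>
  Take a maximal set \<open>A\<close> of variables whose product \<open>x\<^sub>A\<close> is not in the ideal; the empty product
  shows that there is such a set. Each variable outside \<open>A\<close> multiplies \<open>x\<^sub>A\<close> into the ideal by
  maximality, while a square-free generator in the variables of \<open>A\<close> alone would divide \<open>x\<^sub>A\<close>. So
  the colon ideal of \<open>x\<^sub>A\<close> is generated by the variables outside \<open>A\<close>.
\<close>

lemma squarefree_v_witness_exists:
  fixes M :: "('n::finite \<Rightarrow>\<^sub>0 nat) set"
  assumes sqfree: "\<forall>m\<in>M. \<forall>i. Poly_Mapping.lookup m i \<le> 1"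
    and proper: "0 \<notin> M"
  shows "\<exists>d. v_witness (mon_span (multiples M) :: ('n, 'k::field) mpoly set) d"
proof -
  have ideal: "ideal (mon_span (multiples M) :: ('n, 'k) mpoly set) mpoly_ring"
    by (rule ideal_mon_span_multiples)
  have "exp_set {} \<notin> multiples M"
  proof
    assume "exp_set {} \<in> multiples M"
    then obtain g r where gr: "g \<in> M" "g + r = 0" by (auto simp: multiples_def exp_set_def)
    from gr(2) have "monom_degree (g + r) = 0" by (simp only: monom_degree_eq_0_iff)
    then have "g = 0" by (simp add: monom_degree_eq_0_iff)
    with gr proper show False by simp
  qed
  then have "finite {A :: 'n set. exp_set A \<notin> multiples M}" "{A. exp_set A \<notin> multiples M} \<noteq> {}"
    by auto
  then obtain A where A: "exp_set A \<notin> multiples M"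
    and max: "\<And>B. A \<subseteq> B \<Longrightarrow> exp_set B \<notin> multiples M \<Longrightarrow> B = A"
    using finite_has_maximal[of "{A :: 'n set. exp_set A \<notin> multiples M}"] by blast
  have "v_witness (mon_span (multiples M) :: ('n, 'k) mpoly set) (monom_degree (exp_set A))"
  proof (rule v_witness_monomial[where P = "- A"])
    fix i assume "i \<in> - A"
    then have "exp_var i + exp_set A = exp_set (insert i A)" by (simp add: exp_set_def)
    moreover have "exp_set (insert i A) \<in> multiples M" using max[of "insert i A"] \<open>i \<in> - A\<close> by auto
    ultimately show "Poly_Mapping.single (exp_var i + exp_set A) (1::'k) \<in> mon_span (multiples M)"
      by (simp add: mon_span_def)
  next
    have "0 < deg_in (- A) g" if g: "g \<in> M" for g
    proof (rule ccontr)
      assume "\<not> ?thesis"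
      then have "Poly_Mapping.lookup g i \<le> Poly_Mapping.lookup (exp_set A) i" for i
        using sqfree g by (cases "i \<in> A") (auto simp: lookup_exp_set deg_in_def)
      then have "exp_set A = g + (exp_set A - g)"
        by (intro poly_mapping_eqI) (simp add: lookup_add lookup_minus)
      with g A show False unfolding multiples_def by blast
    qed
    moreover have "deg_in (- A) (exp_set A) = 0"
      by (simp add: deg_in_def lookup_exp_set)
    ultimately show "(mon_span (multiples M) :: ('n, 'k) mpoly set)
        \<subseteq> mon_span {a. deg_in (- A) (exp_set A) < deg_in (- A) a}"
      by (fastforce simp: mon_span_def multiples_def)
  qed (fact ideal)
  then show ?thesis by blast
qed

theorem theorem4p1:
  fixes I :: "('n::finite, 'k::field) mpoly set"
  assumes "squarefree_monomial_ideal I"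
    and "I \<noteq> {0}"
    and "I \<noteq> carrier mpoly_ring"
    and "int (v_number I) = int (alpha_deg I) - 1"
  shows "\<forall>k::nat. k \<ge> 1 \<longrightarrow>
           int (v_number (ideal_power mpoly_ring I k)) = int (alpha_deg I * k) - 1"
proof (intro allI impI)
  fix k :: nat assume "k \<ge> 1"
  then obtain l where k: "k = Suc l" by (cases k) auto
  obtain M where sqfree: "\<forall>m\<in>M. \<forall>i. Poly_Mapping.lookup m i \<le> 1"
    and I: "I = mon_span (multiples M)"
    using assms(1) unfolding squarefree_monomial_ideal_def genideal_monomials by blast
  have ideal: "ideal I mpoly_ring"
    unfolding I by (rule ideal_mon_span_multiples)
  have gen: "Poly_Mapping.single g 1 \<in> I" if "g \<in> M" for g
    using self_in_multiples[OF that] by (simp add: I mon_span_def)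

  define \<alpha> where "\<alpha> = alpha_deg I"
  have \<alpha>: "Suc (v_number I) = \<alpha>" using assms(4) by (simp add: \<alpha>_def)
  have gen_deg: "\<alpha> \<le> monom_degree g" if "g \<in> M" for g
    unfolding \<alpha>_def alpha_deg_def
    by (rule Least_le, rule bexI[of _ "Poly_Mapping.single g 1"])
       (use gen[OF that] in \<open>auto simp: graded_comp_def monomial_nonzero\<close>)
  have "0 \<notin> M"
  proof
    assume "0 \<in> M"
    from gen_deg[OF this] \<alpha> show False by (simp add: monom_degree_eq_0_iff[THEN iffD2])
  qed
  have I_deg: "I \<subseteq> mon_span {m. \<alpha> \<le> deg_in UNIV m}"
    using gen_deg by (fastforce simp: I mon_span_def multiples_def)

  have "v_witness I (v_number I)"
    unfolding v_number_eq_Least_v_witness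
    using squarefree_v_witness_exists[OF sqfree \<open>0 \<notin> M\<close>] by (auto simp: I intro: LeastI_ex)
  then obtain f where f: "f \<in> graded_comp (v_number I)"
    and p: "primeideal (colon_ideal mpoly_ring I f) mpoly_ring"
    by (auto simp: v_witness_def)
  define P where
    "P = {i. Poly_Mapping.single (exp_var i) 1 \<in> colon_ideal mpoly_ring I f}"
  have "f \<noteq> 0"
    using primeideal.I_notcarr[OF p] ideal_0[OF ideal] by (auto simp: colon_ideal_def)
  then obtain m where m: "m \<in> Poly_Mapping.keys f" by fastforce
  have m_deg: "Suc (monom_degree m) = \<alpha>"
    using f m \<alpha> by (simp add: graded_comp_def)
  \<comment> \<open>\<open>x\<^sub>i x\<^sup>m\<close> has the smallest degree that occurs in \<open>I\<close>, so the generator dividing it is all of it\<close>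
  have cover: "exp_var i + m \<in> M" if "i \<in> P" for i
  proof -
    have "f * Poly_Mapping.single (exp_var i) 1 \<in> I"
      using that by (simp add: P_def colon_ideal_def mult.commute)
    then have "m + exp_var i \<in> multiples M"
      unfolding I by (rule mon_spanD) (rule add_in_keys_mult_monomial[OF m])
    then obtain g r where gr: "g \<in> M" "m + exp_var i = g + r" by (auto simp: multiples_def)
    have "Suc (monom_degree m) = monom_degree g + monom_degree r"
      using arg_cong[OF gr(2), of monom_degree] by simp
    then have "r = 0" using gen_deg[OF gr(1)] m_deg by (simp flip: monom_degree_eq_0_iff)
    with gr show ?thesis by (simp add: add.commute)
  qed
  have "Poly_Mapping.lookup m i = 0" if "i \<in> P" for i
  proof -
    have "Poly_Mapping.lookup (exp_var i + m) i \<le> 1" using sqfree cover[OF that] by blast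
    then show ?thesis by (simp add: lookup_add)
  qed
  then have m_P: "deg_in P m = 0" by (simp add: deg_in_def)
  have gen_P: "\<exists>i\<in>P. \<exists>r. g = exp_var i + r" if g: "g \<in> M" for g
  proof -
    have "f * Poly_Mapping.single g 1 \<in> I" by (intro ideal_mult ideal gen g)
    then have "Poly_Mapping.single g 1 \<in> colon_ideal mpoly_ring I f"
      by (simp add: colon_ideal_def mult.commute)
    from primeideal_contains_variable[OF p this] show ?thesis by (auto simp: P_def)
  qed
  have I_P: "I \<subseteq> mon_span {a. 1 \<le> deg_in P a}"
    using gen_P by (fastforce simp: I mon_span_def multiples_def)
  have "M \<noteq> {}"
    using assms(2) by (auto simp: I multiples_def mon_span_def)
  with gen_P obtain j where j: "j \<in> P" by blast

  let ?J = "ideal_power mpoly_ring I k"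
  have J: "ideal ?J mpoly_ring" by (rule ideal_ideal_power[OF ideal])
  \<comment> \<open>\<open>x\<^sup>w = (x\<^sub>j x\<^sup>m)\<^sup>l x\<^sup>m\<close> is one variable of \<open>P\<close> short of a product of \<open>k = l + 1\<close> generators\<close>
  define w where "w = (\<Sum>_<l. exp_var j + m) + m"
  have memJ: "Poly_Mapping.single (exp_var i + w) 1 \<in> ?J" if "i \<in> P" for i
  proof -
    have "Poly_Mapping.single (exp_var j + m) 1 ^ l * Poly_Mapping.single (exp_var i + m) 1 \<in> ?J"
      unfolding k by (intro power_mult_in_ideal_power gen cover j that)
    then show ?thesis by (simp add: single_power_replicate mult_single w_def ac_simps)
  qed
  have "monom_degree w = l * Suc (monom_degree m) + monom_degree m"
    by (simp add: w_def monom_degree_replicate del: sum_constant)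
  with m_deg have w_deg: "Suc (monom_degree w) = \<alpha> * k"
    by (simp add: k mult.commute flip: m_deg)
  have "v_number ?J = monom_degree w"
    unfolding v_number_eq_Least_v_witness
  proof (rule Least_equality)
    show "v_witness ?J (monom_degree w)"
    proof (rule v_witness_monomial[OF J _ memJ])
      have "deg_in P w < 1 * k" using m_P j by (simp add: w_def deg_in_replicate k del: sum_constant)
      with ideal_power_subset_mon_span[OF I_P, of k]
      show "?J \<subseteq> mon_span {a. deg_in P w < deg_in P a}" by (fastforce simp: mon_span_def)
    qed
  next
    fix d assume "v_witness ?J d"
    from v_witness_lower_bound[OF J _ memJ[OF j] this]
    show "monom_degree w \<le> d"
      using ideal_power_subset_mon_span[OF I_deg, of k] w_deg by fastforce
  qed
  with w_deg show "int (v_number ?J) = int (alpha_deg I * k) - 1"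
    unfolding \<alpha>_def by linarith
qed

end
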